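(* Let $\mathcal{M}_0$ be the set of isometry classes of $0$-dimensional compact metric spaces, equipped with the Gromov-Hausdorff distance $d_{GH}$. Then the set of isometry classes of $0$-dimensional compact metric spaces that are loosely embeddable in $\mathbb{R}$ (i.e. that admit a loose embedding into the real line $\mathbb{R}$ with its usual distance) is a residual subset of $(\mathcal{M}_0,d_{GH})$.
   Context: Hausdorff distance: for subsets $X,Y$ of a metric space $(Z,d)$, $d_{H,Z}(X,Y)$ is the infimum of all $\varepsilon>0$ such that $X$ and $Y$ are each contained in the other's $\varepsilon$-neighborhood. Gromov-Hausdorff distance: $d_{GH}(X,Y)=\inf d_{H,Z}(X,Y)$, the infimum being over all metric spaces $Z$ containing $X$ and $Y$ as isometrically embedded subspaces. It is a metric on the set $\mathcal{M}$ of isometry classes of (nonempty) compact metric spaces, and $\mathcal{M}_0\subset\mathcal{M}$ carries the restricted metric. Dimension means covering dimension: a finite open cover has order $n\ge 0$ if there are $n+1$ distinct members with nonempty common intersection but no $n+2$ such members; $\dim X=n$ if every finite open cover of $X$ has a finite open refinement of order $\le n$ and $n$ is the smallest integer with this property ($\dim\emptyset=-1$). For compact metric spaces, being $0$-dimensional is equivalent to being totally disconnected (having a basis of clopen sets). A subset $Y$ of a topological space $T$ is meager (of first category) if it is contained in a countable union of nowhere dense closed subsets of $T$; a subset is residual if it is the complement of a meager subset. A loose embedding of a metric space $(X,d_X)$ into a metric space $(Y,d_Y)$ is a one-to-one continuous map $f:X\to Y$ such that for all $x,x',z,z'\in X$: $d_Y(f(x),f(x'))=d_Y(f(z),f(z'))$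 if and only if $d_X(x,x')=d_X(z,z')$. *)

theory Defs
  imports "HOL-Analysis.Analysis"
begin

section \<open>Isometries and the Gromov-Hausdorff distance\<close>

definition isometric_embedding :: "'a metric \<Rightarrow> 'b metric \<Rightarrow> ('a \<Rightarrow> 'b) \<Rightarrow> bool" where
  "isometric_embedding X Y f \<longleftrightarrow>
     f \<in> mspace X \<rightarrow> mspace Y \<and>
     (\<forall>x\<in>mspace X. \<forall>x'\<in>mspace X. mdist Y (f x) (f x') = mdist X x x')"

definition isometric :: "'a metric \<Rightarrow> 'b metric \<Rightarrow> bool" where
  "isometric X Y \<longleftrightarrow> (\<exists>f. isometric_embedding X Y f \<and> f ` mspace X = mspace Y)"

definition hausdorff_dist :: "'a metric \<Rightarrow> 'a set \<Rightarrow> 'a set \<Rightarrow> real" where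
  "hausdorff_dist Z A B =
     Inf {\<epsilon>. \<epsilon> > 0 \<and> A \<subseteq> (\<Union>b\<in>B. mball_of Z b \<epsilon>) \<and> B \<subseteq> (\<Union>a\<in>A. mball_of Z a \<epsilon>)}"

text \<open>The Hausdorff distance of the images of \<open>X\<close> and \<open>Y\<close> in an ambient space \<open>Z\<close> only
  depends on the union of the two images. That union has no more points than the disjoint sum of
  the carriers, so letting \<open>Z\<close> range over the metric spaces carried by subsets of \<open>'a + 'b\<close>
  loses no generality compared with arbitrary ambient spaces.\<close>

definition gh_dist :: "'a metric \<Rightarrow> 'b metric \<Rightarrow> real" where
  "gh_dist X Y =
     Inf {hausdorff_dist Z (f ` mspace X) (g ` mspace Y) | (Z :: ('a + 'b) metric) f g.
            isometric_embedding X Z f \<and> isometric_embedding Y Z g}"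


section \<open>Covering dimension\<close>

definition finite_open_cover :: "'a topology \<Rightarrow> 'a set set \<Rightarrow> bool" where
  "finite_open_cover T \<U> \<longleftrightarrow> finite \<U> \<and> (\<forall>U\<in>\<U>. openin T U) \<and> \<Union>\<U> = topspace T"

definition cover_has_order :: "'a set set \<Rightarrow> nat \<Rightarrow> bool" where
  "cover_has_order \<U> n \<longleftrightarrow>
     (\<exists>\<F>\<subseteq>\<U>. finite \<F> \<and> card \<F> = n + 1 \<and> \<Inter>\<F> \<noteq> {}) \<and>
     \<not> (\<exists>\<F>\<subseteq>\<U>. finite \<F> \<and> card \<F> = n + 2 \<and> \<Inter>\<F> \<noteq> {})"

definition covers_refinable :: "'a topology \<Rightarrow> nat \<Rightarrow> bool" where
  "covers_refinable T n \<longleftrightarrow>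
     (\<forall>\<U>. finite_open_cover T \<U> \<longrightarrow>
        (\<exists>\<V>. finite_open_cover T \<V> \<and> (\<forall>V\<in>\<V>. \<exists>U\<in>\<U>. V \<subseteq> U) \<and>
             (\<exists>k\<le>n. cover_has_order \<V> k)))"

text \<open>Spaces of infinite dimension satisfy \<open>has_covering_dim T n\<close> for no \<open>n\<close>.\<close>

definition has_covering_dim :: "'a topology \<Rightarrow> int \<Rightarrow> bool" where
  "has_covering_dim T n \<longleftrightarrow>
     (if topspace T = {} then n = -1
      else \<exists>k::nat. n = int k \<and> covers_refinable T k \<and> (\<forall>j<k. \<not> covers_refinable T j))"


section \<open>The space of isometry classes of 0-dimensional compact metric spaces\<close>

text \<open>A compact metric space has at most continuum many points, hence is isometric to a metric
  space carried by a subset of \<open>real\<close> (with an arbitrary metric, unrelated to the usual distance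
  of the reals). Elements of type \<open>real metric\<close> therefore represent all isometry classes of
  compact metric spaces.\<close>

definition isometry_class :: "real metric \<Rightarrow> real metric set" where
  "isometry_class X = {Y. isometric X Y}"

definition zero_dim_compact :: "'a metric \<Rightarrow> bool" where
  "zero_dim_compact X \<longleftrightarrow>
     compact_space (mtopology_of X) \<and> has_covering_dim (mtopology_of X) 0"

definition M0 :: "real metric set set" where
  "M0 = isometry_class ` {X. zero_dim_compact X}"

definition gh_class_dist :: "real metric set \<Rightarrow> real metric set \<Rightarrow> real" where
  "gh_class_dist P Q = gh_dist (SOME X. X \<in> P) (SOME Y. Y \<in> Q)"

text \<open>The locale \<open>Metric_space\<close> demands nonnegativity and symmetry also outside the carrier, where
  the infima above need not be meaningful; hence the distance is set to 0 off \<open>M0\<close>.\<close>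

definition gh_topology :: "real metric set topology" where
  "gh_topology =
     Metric_space.mtopology M0 (\<lambda>P Q. if P \<in> M0 \<and> Q \<in> M0 then gh_class_dist P Q else 0)"


section \<open>Meager and residual sets\<close>

definition meager_in :: "'a topology \<Rightarrow> 'a set \<Rightarrow> bool" where
  "meager_in T Y \<longleftrightarrow>
     Y \<subseteq> topspace T \<and>
     (\<exists>\<C>. countable \<C> \<and> (\<forall>C\<in>\<C>. closedin T C \<and> T interior_of C = {}) \<and> Y \<subseteq> \<Union>\<C>)"

definition residual_in :: "'a topology \<Rightarrow> 'a set \<Rightarrow> bool" where
  "residual_in T R \<longleftrightarrow> R \<subseteq> topspace T \<and> meager_in T (topspace T - R)"


section \<open>Loose embeddings\<close>

definition loose_embedding :: "'a metric \<Rightarrow> 'b metric \<Rightarrow> ('a \<Rightarrow> 'b) \<Rightarrow> bool" where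
  "loose_embedding X Y f \<longleftrightarrow>
     continuous_map (mtopology_of X) (mtopology_of Y) f \<and> inj_on f (mspace X) \<and>
     (\<forall>x\<in>mspace X. \<forall>x'\<in>mspace X. \<forall>z\<in>mspace X. \<forall>z'\<in>mspace X.
        mdist Y (f x) (f x') = mdist Y (f z) (f z') \<longleftrightarrow> mdist X x x' = mdist X z z')"

definition loosely_embeddable :: "'a metric \<Rightarrow> 'b metric \<Rightarrow> bool" where
  "loosely_embeddable X Y \<longleftrightarrow> (\<exists>f. loose_embedding X Y f)"


section \<open>The distance of classes does not depend on the representatives\<close>

lemma isometric_embedding_compose:
  "isometric_embedding X Y f \<Longrightarrow> isometric_embedding Y Z g \<Longrightarrow> isometric_embedding X Z (g \<circ> f)"
  unfolding isometric_embedding_def Pi_iff by simp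

lemma isometric_refl: "isometric X X"
  unfolding isometric_def isometric_embedding_def by (intro exI[of _ id]) auto

lemma isometric_sym:
  assumes "isometric X Y" shows "isometric Y X"
proof -
  obtain f where f: "isometric_embedding X Y f" "f ` mspace X = mspace Y"
    using assms unfolding isometric_def by blast
  let ?g = "inv_into (mspace X) f"
  have inj: "inj_on f (mspace X)"
  proof (rule inj_onI)
    fix x y assume xy: "x \<in> mspace X" "y \<in> mspace X" "f x = f y"
    then have "mdist X x y = mdist Y (f x) (f x)"
      using f unfolding isometric_embedding_def by metis
    also have "\<dots> = 0" using xy f by (metis image_eqI mdist_zero)
    finally show "x = y" using xy by simp
  qed
  have g: "?g y \<in> mspace X" "f (?g y) = y" if "y \<in> mspace Y" for y
    using that f(2) by (auto simp: inv_into_into f_inv_into_f)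
  have "isometric_embedding Y X ?g"
    unfolding isometric_embedding_def using g f(1)
    by (auto simp: isometric_embedding_def) metis
  moreover have "?g ` mspace Y = mspace X"
    using inj f(2) by (metis inv_into_image_cancel subset_refl)
  ultimately show ?thesis unfolding isometric_def by blast
qed

lemma gh_dist_cong:
  fixes X X' :: "'a metric" and Y Y' :: "'b metric"
  assumes "isometric X X'" "isometric Y Y'"
  shows "gh_dist X Y = gh_dist X' Y'"
proof -
  have sub: "{hausdorff_dist Z (f ` mspace A') (g ` mspace B') | (Z :: ('a + 'b) metric) f g.
            isometric_embedding A' Z f \<and> isometric_embedding B' Z g} \<subseteq>
        {hausdorff_dist Z (f ` mspace A) (g ` mspace B) | (Z :: ('a + 'b) metric) f g.
            isometric_embedding A Z f \<and> isometric_embedding B Z g}"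
    if AB: "isometric A A'" "isometric B B'" for A A' :: "'a metric" and B B' :: "'b metric"
  proof -
    obtain h k where h: "isometric_embedding A A' h" "h ` mspace A = mspace A'"
      and k: "isometric_embedding B B' k" "k ` mspace B = mspace B'"
      using AB unfolding isometric_def by blast
    show ?thesis
    proof clarify
      fix Z :: "('a + 'b) metric" and f g
      assume fg: "isometric_embedding A' Z f" "isometric_embedding B' Z g"
      have "isometric_embedding A Z (f \<circ> h)" "isometric_embedding B Z (g \<circ> k)"
        using fg h k isometric_embedding_compose by blast+
      moreover have "f ` mspace A' = (f \<circ> h) ` mspace A" "g ` mspace B' = (g \<circ> k) ` mspace B"
        by (simp_all only: image_comp[symmetric] h(2) k(2))
      ultimately show "\<exists>Z' f' g'. hausdorff_dist Z (f ` mspace A') (g ` mspace B') =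
          hausdorff_dist Z' (f' ` mspace A) (g' ` mspace B) \<and>
          isometric_embedding A (Z' :: ('a + 'b) metric) f' \<and> isometric_embedding B Z' g'"
        by metis
    qed
  qed
  show ?thesis
    unfolding gh_dist_def
    using sub[OF assms] sub[OF isometric_sym[OF assms(1)] isometric_sym[OF assms(2)]]
    by (metis (no_types, lifting) subset_antisym)
qed

lemma gh_class_dist_isometry_class:
  "gh_class_dist (isometry_class X) (isometry_class Y) = gh_dist X Y"
proof -
  have "isometric X (SOME X'. X' \<in> isometry_class X)" for X
    using someI[of "\<lambda>X'. X' \<in> isometry_class X" X] isometric_refl
    by (auto simp: isometry_class_def)
  then show ?thesis
    unfolding gh_class_dist_def by (metis gh_dist_cong)
qed

end

theory Submission
  imports Defs
begin

text \<open>If the distances between different pairs of points of a 0-dimensional compact space \<open>X\<close> are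
  pairwise different, then every continuous injection of \<open>X\<close> onto a Sidon set of reals is a loose
  embedding, and such an injection exists because \<open>X\<close> has arbitrarily fine finite clopen partitions.
  The spaces violating this condition are a countable union of sets on which a coincidence of two
  distances is witnessed with a fixed margin. Each of these sets is nowhere dense: finite spaces with
  pairwise different distances are dense, and such a space has a whole ball of spaces without a
  coincidence of that margin.\<close>


section \<open>The Gromov-Hausdorff distance via correspondences\<close>

text \<open>A loose embedding must reproduce every coincidence between distances and create no
  others. If \<open>X\<close> has only the trivial ones, so must the image:
  \<open>\<bar>f x - f x'\<bar> = \<bar>f z - f z'\<bar>\<close> unfolds to an equation between sums
  of two values, which is where Sidon sets enter, and the metric of \<open>X\<close> imposes nothing
  further on \<open>f\<close>. A coincidence may degenerate to a trivial one in a limit, so the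
  margin has to bound the distance away from 0 and also keep the two pairs apart under both
  matchings of their endpoints. A finite space resists such coincidences because its finitely many
  distances have a positive gap. All this happens in a metric on isometry classes whose axioms have
  to be verified first. Infima over ambient spaces are awkward to compose, so they are replaced by
  correspondences: the Gromov-Hausdorff distance is half the infimum of the distortions.\<close>

definition correspondence :: "'a metric \<Rightarrow> 'b metric \<Rightarrow> real \<Rightarrow> ('a \<times> 'b) set \<Rightarrow> bool" where
  "correspondence X Y \<epsilon> R \<longleftrightarrow>
     R \<subseteq> mspace X \<times> mspace Y \<and>
     (\<forall>x\<in>mspace X. \<exists>y. (x, y) \<in> R) \<and> (\<forall>y\<in>mspace Y. \<exists>x. (x, y) \<in> R) \<and>
     (\<forall>x y x' y'. (x, y) \<in> R \<longrightarrow> (x', y') \<in> R \<longrightarrow> \<bar>mdist X x x' - mdist Y y y'\<bar> \<le> \<epsilon>)"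

lemma correspondenceD:
  assumes "correspondence X Y \<epsilon> R"
  shows "(x, y) \<in> R \<Longrightarrow> x \<in> mspace X" "(x, y) \<in> R \<Longrightarrow> y \<in> mspace Y"
    "x \<in> mspace X \<Longrightarrow> \<exists>y. (x, y) \<in> R" "y \<in> mspace Y \<Longrightarrow> \<exists>x. (x, y) \<in> R"
    "(x, y) \<in> R \<Longrightarrow> (x', y') \<in> R \<Longrightarrow> \<bar>mdist X x x' - mdist Y y y'\<bar> \<le> \<epsilon>"
  using assms unfolding correspondence_def by blast+

lemma correspondence_converse:
  assumes "correspondence X Y \<epsilon> R" shows "correspondence Y X \<epsilon> (R\<inverse>)"
  using assms unfolding correspondence_def by (auto simp: abs_minus_commute)

lemma correspondence_comp:
  assumes R: "correspondence X Y \<epsilon> R" and S: "correspondence Y Z \<delta> S"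
  shows "correspondence X Z (\<epsilon> + \<delta>) (R O S)"
  unfolding correspondence_def
proof (intro conjI ballI allI impI)
  show "R O S \<subseteq> mspace X \<times> mspace Z"
    using correspondenceD(1)[OF R] correspondenceD(2)[OF S] by auto
  show "\<exists>z. (x, z) \<in> R O S" if "x \<in> mspace X" for x
    using correspondenceD(2,3)[OF R] correspondenceD(3)[OF S] that by (metis relcomp.relcompI)
  show "\<exists>x. (x, z) \<in> R O S" if "z \<in> mspace Z" for z
    using correspondenceD(4)[OF R] correspondenceD(1,4)[OF S] that by (metis relcomp.relcompI)
next
  fix x z x' z' assume "(x, z) \<in> R O S" "(x', z') \<in> R O S"
  then obtain y y' where "(x, y) \<in> R" "(y, z) \<in> S" "(x', y') \<in> R" "(y', z') \<in> S"
    by (elim relcompE) simp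
  then show "\<bar>mdist X x x' - mdist Z z z'\<bar> \<le> \<epsilon> + \<delta>"
    using correspondenceD(5)[OF R, of x y x' y'] correspondenceD(5)[OF S, of y z y' z'] by linarith
qed

text \<open>The metric on the disjoint sum in which related points have distance \<open>r\<close>.\<close>

definition glue_cross :: "'a metric \<Rightarrow> 'b metric \<Rightarrow> real \<Rightarrow> ('a \<times> 'b) set \<Rightarrow> 'a \<Rightarrow> 'b \<Rightarrow> real" where
  "glue_cross X Y r R a b = Inf ((\<lambda>(x, y). mdist X a x + mdist Y y b) ` R) + r"

fun glue_dist :: "'a metric \<Rightarrow> 'b metric \<Rightarrow> real \<Rightarrow> ('a \<times> 'b) set \<Rightarrow> 'a + 'b \<Rightarrow> 'a + 'b \<Rightarrow> real" where
  "glue_dist X Y r R (Inl a) (Inl a') = mdist X a a'"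
| "glue_dist X Y r R (Inr b) (Inr b') = mdist Y b b'"
| "glue_dist X Y r R (Inl a) (Inr b) = glue_cross X Y r R a b"
| "glue_dist X Y r R (Inr b) (Inl a) = glue_cross X Y r R a b"

lemma glue_cross_le:
  assumes "(x, y) \<in> R"
  shows "glue_cross X Y r R a b \<le> mdist X a x + mdist Y y b + r"
proof -
  have "bdd_below ((\<lambda>(x, y). mdist X a x + mdist Y y b) ` R)"
    by (rule bdd_belowI[of _ 0]) auto
  from cINF_lower[OF this assms] show ?thesis by (simp add: glue_cross_def)
qed

lemma glue_cross_approx:
  assumes "R \<noteq> {}" "e > 0"
  obtains x y where "(x, y) \<in> R" "mdist X a x + mdist Y y b + r < glue_cross X Y r R a b + e"
proof -
  let ?S = "(\<lambda>(x, y). mdist X a x + mdist Y y b) ` R"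
  have "\<exists>s\<in>?S. s < Inf ?S + e"
    by (rule cInf_lessD) (use assms in auto)
  then show ?thesis using that by (force simp: glue_cross_def)
qed

lemma glue_cross_ge:
  assumes "R \<noteq> {}" "\<And>x y. (x, y) \<in> R \<Longrightarrow> c \<le> mdist X a x + mdist Y y b + r"
  shows "c \<le> glue_cross X Y r R a b"
proof (rule field_le_epsilon)
  fix e :: real assume "e > 0"
  obtain x y where "(x, y) \<in> R" "mdist X a x + mdist Y y b + r < glue_cross X Y r R a b + e"
    using glue_cross_approx[OF assms(1) \<open>e > 0\<close>] by blast
  then show "c \<le> glue_cross X Y r R a b + e" using assms(2)[of x y] by linarith
qed

text \<open>The offset \<open>r\<close> and the distortion bound \<open>2 * r\<close> are matched: a
  detour through the other summand crosses twice and so pays \<open>2 * r\<close>, which covers what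
  \<open>R\<close> may shorten a distance by. Positivity of \<open>r\<close> separates points of
  different summands.\<close>

lemma Metric_space_glue:
  assumes R: "correspondence X Y (2 * r) R" and ne: "R \<noteq> {}" and r: "r > 0"
  shows "Metric_space (mspace X <+> mspace Y) (glue_dist X Y r R)"
proof -
  let ?c = "glue_cross X Y r R"
  have pos: "r \<le> ?c a b" for a b
    by (rule glue_cross_ge[OF ne]) simp
  have t1: "?c a b \<le> mdist X a a' + ?c a' b" if "a \<in> mspace X" "a' \<in> mspace X" for a a' b
  proof -
    have "?c a b - mdist X a a' \<le> ?c a' b"
    proof (rule glue_cross_ge[OF ne])
      fix x y assume xy: "(x, y) \<in> R"
      have "mdist X a x \<le> mdist X a a' + mdist X a' x"
        using that xy correspondenceD[OF R] mdist_triangle by metis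
      then show "?c a b - mdist X a a' \<le> mdist X a' x + mdist Y y b + r"
        using glue_cross_le[OF xy, of X Y r a b] by linarith
    qed
    then show ?thesis by linarith
  qed
  have t2: "?c a b \<le> ?c a b' + mdist Y b' b" if "b \<in> mspace Y" "b' \<in> mspace Y" for a b b'
  proof -
    have "?c a b - mdist Y b' b \<le> ?c a b'"
    proof (rule glue_cross_ge[OF ne])
      fix x y assume xy: "(x, y) \<in> R"
      have "mdist Y y b \<le> mdist Y y b' + mdist Y b' b"
        using that xy correspondenceD[OF R] mdist_triangle by metis
      then show "?c a b - mdist Y b' b \<le> mdist X a x + mdist Y y b' + r"
        using glue_cross_le[OF xy, of X Y r a b] by linarith
    qed
    then show ?thesis by linarith
  qed
  have t3: "mdist X a a' \<le> ?c a b + ?c a' b"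
    if "a \<in> mspace X" "a' \<in> mspace X" "b \<in> mspace Y" for a a' b
  proof -
    \<comment> \<open>The two infima are bounded one at a time, since each crossing may use its own
      pair of \<open>R\<close>; comparing the two pairs is what needs the distortion bound.\<close>
    have "mdist X a a' - ?c a' b \<le> ?c a b"
    proof (rule glue_cross_ge[OF ne])
      fix x y assume xy: "(x, y) \<in> R"
      have "mdist X a a' - (mdist X a x + mdist Y y b + r) \<le> ?c a' b"
      proof (rule glue_cross_ge[OF ne])
        fix x' y' assume xy': "(x', y') \<in> R"
        have "mdist X a a' \<le> mdist X a x + mdist X x x' + mdist X a' x'"
          using that xy xy' correspondenceD[OF R]
          by (smt (verit) mdist_triangle mdist_commute)
        moreover have "mdist Y y y' \<le> mdist Y y b + mdist Y y' b"
          using that xy xy' correspondenceD[OF R]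
          by (smt (verit) mdist_triangle mdist_commute)
        ultimately show "mdist X a a' - (mdist X a x + mdist Y y b + r)
            \<le> mdist X a' x' + mdist Y y' b + r"
          using correspondenceD(5)[OF R xy xy'] by linarith
      qed
      then show "mdist X a a' - ?c a' b \<le> mdist X a x + mdist Y y b + r" by linarith
    qed
    then show ?thesis by linarith
  qed
  have t4: "mdist Y b b' \<le> ?c a b + ?c a b'"
    if "a \<in> mspace X" "b \<in> mspace Y" "b' \<in> mspace Y" for a b b'
  proof -
    have "mdist Y b b' - ?c a b' \<le> ?c a b"
    proof (rule glue_cross_ge[OF ne])
      fix x y assume xy: "(x, y) \<in> R"
      have "mdist Y b b' - (mdist X a x + mdist Y y b + r) \<le> ?c a b'"
      proof (rule glue_cross_ge[OF ne])
        fix x' y' assume xy': "(x', y') \<in> R"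
        have "mdist Y b b' \<le> mdist Y y b + mdist Y y y' + mdist Y y' b'"
          using that xy xy' correspondenceD[OF R]
          by (smt (verit) mdist_triangle mdist_commute)
        moreover have "mdist X x x' \<le> mdist X a x + mdist X a x'"
          using that xy xy' correspondenceD[OF R]
          by (smt (verit) mdist_triangle mdist_commute)
        ultimately show "mdist Y b b' - (mdist X a x + mdist Y y b + r)
            \<le> mdist X a x' + mdist Y y' b' + r"
          using correspondenceD(5)[OF R xy xy'] by linarith
      qed
      then show "mdist Y b b' - ?c a b' \<le> mdist X a x + mdist Y y b + r" by linarith
    qed
    then show ?thesis by linarith
  qed
  have pos': "?c a b > 0" for a b using pos[of a b] r by linarith
  show ?thesis
  proof
    show "0 \<le> glue_dist X Y r R u v" for u v
      using pos' less_imp_le by (cases u; cases v) auto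
    show "glue_dist X Y r R u v = glue_dist X Y r R v u" for u v
      by (cases u; cases v) (auto simp: mdist_commute)
    show "(glue_dist X Y r R u v = 0) = (u = v)"
      if "u \<in> mspace X <+> mspace Y" "v \<in> mspace X <+> mspace Y" for u v
      using that pos' less_irrefl by (auto simp: less_imp_neq[symmetric])
    show "glue_dist X Y r R u w \<le> glue_dist X Y r R u v + glue_dist X Y r R v w"
      if "u \<in> mspace X <+> mspace Y" "v \<in> mspace X <+> mspace Y" "w \<in> mspace X <+> mspace Y"
      for u v w
    proof (cases u; cases v; cases w)
      fix a a' a'' assume "u = Inl a" "v = Inl a'" "w = Inl a''"
      with that show ?thesis by (auto intro: mdist_triangle)
    next
      fix a a' b assume "u = Inl a" "v = Inl a'" "w = Inr b"
      with that show ?thesis by (auto intro: t1)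
    next
      fix a b a' assume "u = Inl a" "v = Inr b" "w = Inl a'"
      with that show ?thesis by (auto intro: t3)
    next
      fix a b b' assume "u = Inl a" "v = Inr b" "w = Inr b'"
      with that show ?thesis by (auto intro: t2)
    next
      fix b a a' assume "u = Inr b" "v = Inl a" "w = Inl a'"
      with that t1[of a' a b] show ?thesis by (auto simp: mdist_commute)
    next
      fix b a b' assume "u = Inr b" "v = Inl a" "w = Inr b'"
      with that show ?thesis by (auto intro: t4)
    next
      fix b b' a assume "u = Inr b" "v = Inr b'" "w = Inl a"
      with that t2[of b b' a] show ?thesis by (auto simp: mdist_commute)
    next
      fix b b' b'' assume "u = Inr b" "v = Inr b'" "w = Inr b''"
      with that show ?thesis by (auto intro: mdist_triangle)
    qed
  qed
qed

text \<open>\<open>Inf\<close> of the empty set of reals carries no information. Nonempty bounded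
  carriers ensure that the sets of radii and of Hausdorff distances are nonempty.\<close>

definition bounded_space :: "'a metric \<Rightarrow> bool" where
  "bounded_space X \<longleftrightarrow> mspace X \<noteq> {} \<and> (\<exists>B. \<forall>x\<in>mspace X. \<forall>y\<in>mspace X. mdist X x y \<le> B)"

lemma compact_imp_bounded_space:
  assumes "compact_space (mtopology_of X)" "mspace X \<noteq> {}"
  shows "bounded_space X"
proof -
  interpret Metric_space "mspace X" "mdist X" by (rule Metric_space_mspace_mdist)
  have "mbounded (mspace X)"
    using assms compactin_imp_mbounded unfolding compact_space_def mtopology_of_def by auto
  then show ?thesis using assms by (auto simp: bounded_space_def mbounded_alt)
qed

section \<open>From the Gromov-Hausdorff distance to distortion and back\<close>

lemma hausdorff_set_nonempty:
  assumes X: "bounded_space X" and Y: "bounded_space Y"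
    and f: "isometric_embedding X Z f" and g: "isometric_embedding Y Z g"
  shows "{\<epsilon>. \<epsilon> > 0 \<and> f ` mspace X \<subseteq> (\<Union>b\<in>g ` mspace Y. mball_of Z b \<epsilon>) \<and>
              g ` mspace Y \<subseteq> (\<Union>a\<in>f ` mspace X. mball_of Z a \<epsilon>)} \<noteq> {}"
proof -
  obtain x0 B where x0: "x0 \<in> mspace X" and B: "\<And>x x'. x \<in> mspace X \<Longrightarrow> x' \<in> mspace X \<Longrightarrow> mdist X x x' \<le> B"
    using X unfolding bounded_space_def by blast
  obtain y0 C where y0: "y0 \<in> mspace Y" and C: "\<And>x x'. x \<in> mspace Y \<Longrightarrow> x' \<in> mspace Y \<Longrightarrow> mdist Y x x' \<le> C"
    using Y unfolding bounded_space_def by blast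
  let ?D = "mdist Z (f x0) (g y0)"
  have mem: "f x \<in> mspace Z" if "x \<in> mspace X" for x using that f by (auto simp: isometric_embedding_def)
  have mem': "g y \<in> mspace Z" if "y \<in> mspace Y" for y using that g by (auto simp: isometric_embedding_def)
  have "B \<ge> 0" using B[OF x0 x0] mdist_nonneg[of X x0 x0] by linarith
  have "C \<ge> 0" using C[OF y0 y0] mdist_nonneg[of Y y0 y0] by linarith
  have 1: "mdist Z (g y0) (f x) \<le> B + ?D" if "x \<in> mspace X" for x
    using mdist_triangle[of "g y0" Z "f x0" "f x"] B[OF x0 that] f x0 that mem mem'[OF y0]
      mdist_commute[of Z "g y0" "f x0"]
    by (auto simp: isometric_embedding_def)
  have 2: "mdist Z (f x0) (g y) \<le> C + ?D" if "y \<in> mspace Y" for y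
    using mdist_triangle[of "f x0" Z "g y0" "g y"] C[OF y0 that] g y0 that mem' mem[OF x0]
    by (auto simp: isometric_embedding_def)
  have "B + C + ?D + 1 > 0" using \<open>B \<ge> 0\<close> \<open>C \<ge> 0\<close> mdist_nonneg[of Z "f x0" "g y0"] by linarith
  moreover have "f x \<in> mball_of Z (g y0) (B + C + ?D + 1)" if "x \<in> mspace X" for x
    using 1[OF that] \<open>C \<ge> 0\<close> mem[OF that] mem'[OF y0] by simp
  moreover have "g y \<in> mball_of Z (f x0) (B + C + ?D + 1)" if "y \<in> mspace Y" for y
    using 2[OF that] \<open>B \<ge> 0\<close> mem'[OF that] mem[OF x0] by simp
  ultimately have "B + C + ?D + 1 \<in> {\<epsilon>. \<epsilon> > 0 \<and> f ` mspace X \<subseteq> (\<Union>b\<in>g ` mspace Y. mball_of Z b \<epsilon>) \<and>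
              g ` mspace Y \<subseteq> (\<Union>a\<in>f ` mspace X. mball_of Z a \<epsilon>)}"
    using x0 y0 by blast
  then show ?thesis by blast
qed

lemma hausdorff_dist_nonneg:
  assumes "bounded_space X" "bounded_space Y"
    "isometric_embedding X Z f" "isometric_embedding Y Z g"
  shows "0 \<le> hausdorff_dist Z (f ` mspace X) (g ` mspace Y)"
  unfolding hausdorff_dist_def
  by (rule cInf_greatest[OF hausdorff_set_nonempty[OF assms]]) auto

lemma glue_embedding:
  fixes X :: "'a metric" and Y :: "'b metric"
  assumes X: "bounded_space X" and R: "correspondence X Y (2 * r) R" and r: "r > 0"
  obtains Z :: "('a + 'b) metric" where
    "isometric_embedding X Z Inl" "isometric_embedding Y Z Inr"
    "hausdorff_dist Z (Inl ` mspace X) (Inr ` mspace Y) \<le> r"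
proof -
  have ne: "R \<noteq> {}" using X correspondenceD(3)[OF R] by (auto simp: bounded_space_def)
  interpret Z: Metric_space "mspace X <+> mspace Y" "glue_dist X Y r R"
    by (rule Metric_space_glue[OF R ne r])
  define Z where "Z = metric (mspace X <+> mspace Y, glue_dist X Y r R)"
  have Zs[simp]: "mspace Z = mspace X <+> mspace Y" "mdist Z = glue_dist X Y r R"
    using Z.mspace_metric Z.mdist_metric by (auto simp: Z_def)
  have near: "glue_cross X Y r R x y \<le> r" if "(x, y) \<in> R" for x y
  proof -
    have "mdist X x x = 0" "mdist Y y y = 0"
      using correspondenceD(1,2)[OF R that] by auto
    then show ?thesis using glue_cross_le[OF that, of X Y r x y] by linarith
  qed
  have "hausdorff_dist Z (Inl ` mspace X) (Inr ` mspace Y) \<le> r"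
  \<comment> \<open>Related points are at distance at most \<open>r\<close>, but balls are open, so
    only radii \<open>r' > r\<close> are sure to be admissible.\<close>
  proof (rule dense_ge)
    fix r' assume r': "r < r'"
    have "Inl x \<in> (\<Union>b\<in>Inr ` mspace Y. mball_of Z b r')" if x: "x \<in> mspace X" for x
    proof -
      obtain y where "(x, y) \<in> R" using correspondenceD(3)[OF R x] by blast
      then have "Inl x \<in> mball_of Z (Inr y) r'" "y \<in> mspace Y"
        using near[of x y] r' x correspondenceD(2)[OF R] by auto
      then show ?thesis by blast
    qed
    moreover have "Inr y \<in> (\<Union>a\<in>Inl ` mspace X. mball_of Z a r')" if y: "y \<in> mspace Y" for y
    proof -
      obtain x where "(x, y) \<in> R" using correspondenceD(4)[OF R y] by blast
      then have "Inr y \<in> mball_of Z (Inl x) r'" "x \<in> mspace X"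
        using near[of x y] r' y correspondenceD(1)[OF R] by auto
      then show ?thesis by blast
    qed
    ultimately show "hausdorff_dist Z (Inl ` mspace X) (Inr ` mspace Y) \<le> r'"
      unfolding hausdorff_dist_def using r r'
      by (intro cInf_lower) (auto intro!: bdd_belowI[of _ 0])
  qed
  then show ?thesis
    by (intro that[of Z]) (auto simp: isometric_embedding_def)
qed

lemma gh_dist_le:
  fixes X :: "'a metric" and Y :: "'b metric"
  assumes X: "bounded_space X" and Y: "bounded_space Y"
    and R: "correspondence X Y (2 * r) R" and r: "r > 0"
  shows "gh_dist X Y \<le> r"
proof -
  obtain Z :: "('a + 'b) metric" where Z: "isometric_embedding X Z Inl" "isometric_embedding Y Z Inr"
    "hausdorff_dist Z (Inl ` mspace X) (Inr ` mspace Y) \<le> r"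
    using glue_embedding[OF X R r] by blast
  have "gh_dist X Y \<le> hausdorff_dist Z (Inl ` mspace X) (Inr ` mspace Y)"
    unfolding gh_dist_def using Z hausdorff_dist_nonneg[OF X Y]
    by (intro cInf_lower) (auto intro!: bdd_belowI[of _ 0])
  then show ?thesis using Z by linarith
qed

text \<open>Any finite distortion will do: relating all points yields one common ambient space, so
  that the infimum in \<open>gh_dist\<close> ranges over a nonempty set.\<close>

lemma trivial_correspondence:
  assumes X: "bounded_space X" and Y: "bounded_space Y"
  obtains r where "r > 0" "correspondence X Y (2 * r) (mspace X \<times> mspace Y)"
proof -
  obtain x0 B where x0: "x0 \<in> mspace X" and B: "\<And>x x'. x \<in> mspace X \<Longrightarrow> x' \<in> mspace X \<Longrightarrow> mdist X x x' \<le> B"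
    using X unfolding bounded_space_def by blast
  obtain y0 C where y0: "y0 \<in> mspace Y" and C: "\<And>x x'. x \<in> mspace Y \<Longrightarrow> x' \<in> mspace Y \<Longrightarrow> mdist Y x x' \<le> C"
    using Y unfolding bounded_space_def by blast
  have "B \<ge> 0" using B[OF x0 x0] mdist_nonneg[of X x0 x0] by linarith
  have "C \<ge> 0" using C[OF y0 y0] mdist_nonneg[of Y y0 y0] by linarith
  have "\<bar>mdist X x x' - mdist Y y y'\<bar> \<le> 2 * (B + C + 1)"
    if "x \<in> mspace X" "x' \<in> mspace X" "y \<in> mspace Y" "y' \<in> mspace Y" for x x' y y'
    using B[OF that(1,2)] C[OF that(3,4)] mdist_nonneg[of X x x'] mdist_nonneg[of Y y y']
      \<open>B \<ge> 0\<close> \<open>C \<ge> 0\<close> by argo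
  then have "correspondence X Y (2 * (B + C + 1)) (mspace X \<times> mspace Y)"
    using x0 y0 unfolding correspondence_def by blast
  then show ?thesis using \<open>B \<ge> 0\<close> \<open>C \<ge> 0\<close> by (intro that[of "B + C + 1"]) auto
qed

lemma gh_set_nonempty:
  fixes X :: "'a metric" and Y :: "'b metric"
  assumes X: "bounded_space X" and Y: "bounded_space Y"
  shows "{hausdorff_dist Z (f ` mspace X) (g ` mspace Y) | (Z :: ('a + 'b) metric) f g.
            isometric_embedding X Z f \<and> isometric_embedding Y Z g} \<noteq> {}"
proof -
  obtain r where "r > 0" "correspondence X Y (2 * r) (mspace X \<times> mspace Y)"
    using trivial_correspondence[OF X Y] by blast
  then obtain Z :: "('a + 'b) metric" where
    "isometric_embedding X Z Inl" "isometric_embedding Y Z Inr"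
    using glue_embedding[OF X] by blast
  then show ?thesis by blast
qed

lemma gh_dist_nonneg:
  assumes "bounded_space X" "bounded_space Y"
  shows "0 \<le> gh_dist X Y"
  unfolding gh_dist_def using hausdorff_dist_nonneg[OF assms]
  by (intro cInf_greatest[OF gh_set_nonempty[OF assms]]) auto

text \<open>Points are related when their images in a good ambient space are closer than some
  \<open>\<epsilon> < r\<close>; replacing both ends of a pair then changes its distance by less
  than \<open>2 * r\<close>.\<close>

lemma gh_dist_lessE:
  fixes X :: "'a metric" and Y :: "'b metric"
  assumes X: "bounded_space X" and Y: "bounded_space Y" and less: "gh_dist X Y < r"
  obtains R where "correspondence X Y (2 * r) R"
proof -
  from cInf_lessD[OF gh_set_nonempty[OF X Y] less[unfolded gh_dist_def]]
  obtain Z :: "('a + 'b) metric" and f g where f: "isometric_embedding X Z f"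
    and g: "isometric_embedding Y Z g" and "hausdorff_dist Z (f ` mspace X) (g ` mspace Y) < r"
    by blast
  from cInf_lessD[OF hausdorff_set_nonempty[OF X Y f g] this(3)[unfolded hausdorff_dist_def]]
  obtain \<epsilon> where e: "\<epsilon> < r" "f ` mspace X \<subseteq> (\<Union>b\<in>g ` mspace Y. mball_of Z b \<epsilon>)"
    "g ` mspace Y \<subseteq> (\<Union>a\<in>f ` mspace X. mball_of Z a \<epsilon>)"
    by blast
  define R where "R = {(x, y). x \<in> mspace X \<and> y \<in> mspace Y \<and> mdist Z (f x) (g y) < \<epsilon>}"
  have "\<bar>mdist X x x' - mdist Y y y'\<bar> \<le> 2 * r" if "(x, y) \<in> R" "(x', y') \<in> R" for x y x' y'
  proof -
    have m: "x \<in> mspace X" "y \<in> mspace Y" "x' \<in> mspace X" "y' \<in> mspace Y"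
      "mdist Z (f x) (g y) < \<epsilon>" "mdist Z (f x') (g y') < \<epsilon>"
      using that by (auto simp: R_def)
    then have mm: "f x \<in> mspace Z" "g y \<in> mspace Z" "f x' \<in> mspace Z" "g y' \<in> mspace Z"
      using f g by (auto simp: isometric_embedding_def)
    have "mdist X x x' = mdist Z (f x) (f x')" "mdist Y y y' = mdist Z (g y) (g y')"
      using f g m by (auto simp: isometric_embedding_def)
    then show ?thesis
      using mdist_triangle[OF mm(1,2,3)] mdist_triangle[OF mm(2,4,3)]
        mdist_triangle[OF mm(2,1,4)] mdist_triangle[OF mm(1,3,4)]
        mdist_commute[of Z "g y" "f x"] mdist_commute[of Z "g y'" "f x'"] m e(1) by linarith
  qed
  moreover have "\<exists>y. (x, y) \<in> R" if "x \<in> mspace X" for x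
    using e(2) that unfolding R_def by (fastforce simp: mdist_commute)
  moreover have "\<exists>x. (x, y) \<in> R" if "y \<in> mspace Y" for y
    using e(3) that unfolding R_def by fastforce
  ultimately have "correspondence X Y (2 * r) R"
    unfolding correspondence_def R_def by blast
  then show ?thesis by (rule that)
qed

section \<open>Metric axioms for the Gromov-Hausdorff distance\<close>

lemma gh_dist_commute_le:
  assumes "bounded_space X" "bounded_space Y"
  shows "gh_dist X Y \<le> gh_dist Y X"
proof (rule dense_ge)
  fix r assume r: "gh_dist Y X < r"
  \<comment> \<open>The two infima range over ambient spaces of types \<open>'a + 'b\<close> and
    \<open>'b + 'a\<close>, whereas a correspondence is simply reversed.\<close>
  obtain R where "correspondence Y X (2 * r) R" by (rule gh_dist_lessE[OF assms(2,1) r])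
  from gh_dist_le[OF assms correspondence_converse[OF this]]
  show "gh_dist X Y \<le> r" using r gh_dist_nonneg[OF assms(2,1)] by linarith
qed

lemma gh_dist_commute:
  assumes "bounded_space X" "bounded_space Y"
  shows "gh_dist X Y = gh_dist Y X"
  by (rule order_antisym[OF gh_dist_commute_le[OF assms] gh_dist_commute_le[OF assms(2,1)]])

text \<open>Composing correspondences replaces gluing two ambient spaces along \<open>Y\<close>; the
  slack \<open>e / 2\<close> on either side is there because infima need not be attained.\<close>

lemma gh_dist_triangle:
  assumes X: "bounded_space X" and Y: "bounded_space Y" and W: "bounded_space W"
  shows "gh_dist X W \<le> gh_dist X Y + gh_dist Y W"
proof (rule field_le_epsilon)
  fix e :: real assume e: "e > 0"
  let ?r = "gh_dist X Y + e / 2" and ?s = "gh_dist Y W + e / 2"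
  have lt: "gh_dist X Y < ?r" "gh_dist Y W < ?s" using e by auto
  obtain R where R: "correspondence X Y (2 * ?r) R" by (rule gh_dist_lessE[OF X Y lt(1)])
  obtain S where S: "correspondence Y W (2 * ?s) S" by (rule gh_dist_lessE[OF Y W lt(2)])
  from correspondence_comp[OF R S]
  have "correspondence X W (2 * (?r + ?s)) (R O S)" by (simp add: distrib_left)
  then have "gh_dist X W \<le> ?r + ?s"
    by (rule gh_dist_le[OF X W]) (use e gh_dist_nonneg[OF X Y] gh_dist_nonneg[OF Y W] in linarith)
  then show "gh_dist X W \<le> gh_dist X Y + gh_dist Y W + e" by simp
qed

lemma gh_dist_self:
  assumes "bounded_space X"
  shows "gh_dist X X = 0"
proof -
  have "gh_dist X X \<le> r" if "r > 0" for r
    by (rule gh_dist_le[of _ _ _ "Id_on (mspace X)"])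
      (use assms that in \<open>auto simp: correspondence_def\<close>)
  then have "gh_dist X X \<le> 0" by (meson dense_ge)
  then show ?thesis using gh_dist_nonneg[OF assms assms] by linarith
qed

text \<open>By Tychonoff's theorem, the pairs of maps \<open>(f, g)\<close> that are adjoint up to \<open>1/n\<close> have a common
  limit, and exactly adjoint maps are inverse isometries.\<close>

lemma gh_dist_zero_imp_isometric:
  fixes X :: "'a metric" and Y :: "'b metric"
  assumes cX: "compact_space (mtopology_of X)" and cY: "compact_space (mtopology_of Y)"
    and bX: "bounded_space X" and bY: "bounded_space Y" and zero: "gh_dist X Y = 0"
  shows "isometric X Y"
proof -
  define P where "P = prod_topology (product_topology (\<lambda>_. mtopology_of Y) (mspace X))
                                    (product_topology (\<lambda>_. mtopology_of X) (mspace Y))"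
  have tP: "topspace P = (mspace X \<rightarrow>\<^sub>E mspace Y) \<times> (mspace Y \<rightarrow>\<^sub>E mspace X)"
    by (simp add: P_def)
  have "compact_space P"
    using cX cY by (simp add: P_def compact_space_prod_topology compact_space_product_topology)
  \<comment> \<open>\<open>h\<close> is the defect of adjointness. It reads one coordinate of each
    map, hence is continuous for pointwise convergence although the maps need not be. Surjectivity
    would not survive such limits; an adjoint partner does.\<close>
  define h where "h x y p = \<bar>mdist Y (fst p x) y - mdist X x (snd p y)\<bar>" for x y and p :: "('a \<Rightarrow> 'b) \<times> ('b \<Rightarrow> 'a)"
  have cont: "continuous_map P euclideanreal (h x y)" if "x \<in> mspace X" "y \<in> mspace Y" for x y
  proof -
    have "continuous_map P (mtopology_of Y) ((\<lambda>f. f x) \<circ> fst)"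
      unfolding P_def using that
      by (intro continuous_map_compose[OF continuous_map_fst] continuous_map_product_projection)
    moreover have "continuous_map P (mtopology_of X) ((\<lambda>f. f y) \<circ> snd)"
      unfolding P_def using that
      by (intro continuous_map_compose[OF continuous_map_snd] continuous_map_product_projection)
    ultimately show ?thesis
      unfolding h_def o_def using that by (intro continuous_intros) auto
  qed
  define C where "C n = (\<Inter>(x, y)\<in>mspace X \<times> mspace Y. {p \<in> topspace P. h x y p \<in> {..1 / real (Suc n)}})"
    for n
  have ne: "mspace X \<times> mspace Y \<noteq> {}" using bX bY by (auto simp: bounded_space_def)
  have "closedin P (C n)" for n
  proof -
    have "closedin P {p \<in> topspace P. h x y p \<in> {..1 / real (Suc n)}}"
      if "x \<in> mspace X" "y \<in> mspace Y" for x y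
      by (rule closedin_continuous_map_preimage[OF cont[OF that]]) simp
    then show ?thesis unfolding C_def using ne by (intro closedin_INT) auto
  qed
  moreover have "C n \<noteq> {}" for n
  proof -
    define e where "e = 1 / real (Suc n)"
    have lt: "gh_dist X Y < e / 2" by (simp add: zero e_def)
    obtain R where "correspondence X Y (2 * (e / 2)) R" by (rule gh_dist_lessE[OF bX bY lt])
    then have R: "correspondence X Y e R" by simp
    obtain f where f: "\<And>x. x \<in> mspace X \<Longrightarrow> (x, f x) \<in> R" using correspondenceD(3)[OF R] by metis
    obtain g where g: "\<And>y. y \<in> mspace Y \<Longrightarrow> (g y, y) \<in> R" using correspondenceD(4)[OF R] by metis
    have "h x y (restrict f (mspace X), restrict g (mspace Y)) \<le> e"
      if "x \<in> mspace X" "y \<in> mspace Y" for x y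
      using correspondenceD(5)[OF R f g] that by (simp add: h_def abs_minus_commute)
    moreover have "(restrict f (mspace X), restrict g (mspace Y)) \<in> topspace P"
      using correspondenceD(2)[OF R f] correspondenceD(1)[OF R g] by (simp add: tP restrict_PiE_iff)
    ultimately have "(restrict f (mspace X), restrict g (mspace Y)) \<in> C n"
      by (auto simp: C_def e_def)
    then show ?thesis by blast
  qed
  moreover have "decseq C"
  proof (rule decseq_SucI)
    fix n
    have "1 / real (Suc (Suc n)) \<le> 1 / real (Suc n)" by (simp add: frac_le)
    then show "C (Suc n) \<subseteq> C n" unfolding C_def by fastforce
  qed
  ultimately have "(\<Inter>n. C n) \<noteq> {}"
    using compact_space_imp_nest[OF \<open>compact_space P\<close>] by blast
  then obtain f g where fg: "\<And>n. (f, g) \<in> C n" by auto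
  have fgP: "(f, g) \<in> topspace P" using fg[of 0] ne by (auto simp: C_def)
  have fm: "f x \<in> mspace Y" if "x \<in> mspace X" for x using fgP that by (auto simp: tP)
  have gm: "g y \<in> mspace X" if "y \<in> mspace Y" for y using fgP that by (auto simp: tP)
  have adj: "mdist Y (f x) y = mdist X x (g y)" if "x \<in> mspace X" "y \<in> mspace Y" for x y
  proof -
    have "h x y (f, g) \<le> 1 / real (Suc n)" for n
      using fg[of n] that by (auto simp: C_def)
    then have "h x y (f, g) \<le> 0"
      by (metis not_le nat_approx_posE)
    then show ?thesis by (simp add: h_def)
  qed
  \<comment> \<open>Adjointness with \<open>x = g y\<close> makes the distance from
    \<open>f (g y)\<close> to \<open>y\<close> vanish; with \<open>y = f x'\<close> and
    \<open>g (f x') = x'\<close> it later says that \<open>f\<close> preserves distances.\<close>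
  have fg': "f (g y) = y" if "y \<in> mspace Y" for y
  proof -
    have "mdist X (g y) (g y) = 0" using gm[OF that] by simp
    then show ?thesis using adj[OF gm[OF that] that] fm[OF gm[OF that]] that by simp
  qed
  have gf: "g (f x) = x" if "x \<in> mspace X" for x
  proof -
    have "mdist Y (f x) (f x) = 0" using fm[OF that] by simp
    then show ?thesis using adj[OF that fm[OF that]] gm[OF fm[OF that]] that by simp
  qed
  have "isometric_embedding X Y f"
    unfolding isometric_embedding_def using fm adj gf by auto
  moreover have "f ` mspace X = mspace Y" using fm gm fg' by force
  ultimately show ?thesis unfolding isometric_def by blast
qed

section \<open>Passage to isometry classes\<close>

lemma isometric_trans:
  assumes "isometric X Y" "isometric Y Z"
  shows "isometric X Z"
proof -
  obtain f where f: "isometric_embedding X Y f" "f ` mspace X = mspace Y"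
    using assms(1) unfolding isometric_def by blast
  obtain g where g: "isometric_embedding Y Z g" "g ` mspace Y = mspace Z"
    using assms(2) unfolding isometric_def by blast
  have "(g \<circ> f) ` mspace X = mspace Z"
    by (simp only: image_comp[symmetric] f(2) g(2))
  with isometric_embedding_compose[OF f(1) g(1)] show ?thesis
    unfolding isometric_def by (intro exI[of _ "g \<circ> f"] conjI)
qed

lemma isometry_class_eq_iff: "isometry_class X = isometry_class Y \<longleftrightarrow> isometric X Y"
proof
  assume "isometry_class X = isometry_class Y"
  then show "isometric X Y" using isometric_refl[of Y] by (auto simp: isometry_class_def)
next
  assume "isometric X Y"
  then show "isometry_class X = isometry_class Y"
    unfolding isometry_class_def
    using isometric_trans[OF isometric_sym[OF \<open>isometric X Y\<close>]]
      isometric_trans[OF \<open>isometric X Y\<close>] by (intro Collect_cong iffI)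
qed

text \<open>Dimension 0 rules out the empty carrier, which has dimension -1, so every space
  considered is a \<open>bounded_space\<close>.\<close>

lemma zero_dim_compactD:
  assumes "zero_dim_compact X"
  shows "compact_space (mtopology_of X)" "mspace X \<noteq> {}" "bounded_space X"
proof -
  show *: "compact_space (mtopology_of X)" "mspace X \<noteq> {}"
    using assms by (auto simp: zero_dim_compact_def has_covering_dim_def)
  show "bounded_space X" by (rule compact_imp_bounded_space[OF *])
qed

lemma Metric_space_M0:
  "Metric_space M0 (\<lambda>P Q. if P \<in> M0 \<and> Q \<in> M0 then gh_class_dist P Q else 0)"
proof -
  have M0E: "\<exists>X. P = isometry_class X \<and> zero_dim_compact X" if "P \<in> M0" for P
    using that by (auto simp: M0_def)
  have nonneg: "0 \<le> gh_class_dist P Q" if "P \<in> M0" "Q \<in> M0" for P Q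
    using M0E[OF that(1)] M0E[OF that(2)]
    by (auto simp: gh_class_dist_isometry_class gh_dist_nonneg zero_dim_compactD)
  have comm: "gh_class_dist P Q = gh_class_dist Q P" if "P \<in> M0" "Q \<in> M0" for P Q
    using M0E[OF that(1)] M0E[OF that(2)]
    by (auto simp: gh_class_dist_isometry_class intro!: gh_dist_commute zero_dim_compactD)
  have zero: "gh_class_dist P Q = 0 \<longleftrightarrow> P = Q" if "P \<in> M0" "Q \<in> M0" for P Q
  proof -
    obtain X Y where XY: "P = isometry_class X" "Q = isometry_class Y"
      "zero_dim_compact X" "zero_dim_compact Y"
      using M0E[OF \<open>P \<in> M0\<close>] M0E[OF \<open>Q \<in> M0\<close>] by blast
    show ?thesis
    proof
      assume "gh_class_dist P Q = 0"
      then have "isometric X Y"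
        using XY by (intro gh_dist_zero_imp_isometric)
          (auto simp: gh_class_dist_isometry_class zero_dim_compactD)
      then show "P = Q" using XY isometry_class_eq_iff by blast
    next
      assume "P = Q"
      then show "gh_class_dist P Q = 0"
        using XY by (simp add: gh_class_dist_isometry_class gh_dist_self zero_dim_compactD)
    qed
  qed
  have tri: "gh_class_dist P W \<le> gh_class_dist P Q + gh_class_dist Q W"
    if "P \<in> M0" "Q \<in> M0" "W \<in> M0" for P Q W
    using M0E[OF that(1)] M0E[OF that(2)] M0E[OF that(3)]
    by (auto simp: gh_class_dist_isometry_class intro!: gh_dist_triangle zero_dim_compactD)
  show ?thesis
    by unfold_locales (use nonneg comm zero tri in auto)
qed


section \<open>Loose embeddings into the real line\<close>

text \<open>The guard \<open>x \<noteq> x'\<close> exempts distance 0, which all degenerate pairs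
  share.\<close>

definition distinct_distances :: "'a metric \<Rightarrow> bool" where
  "distinct_distances X \<longleftrightarrow>
     (\<forall>x\<in>mspace X. \<forall>x'\<in>mspace X. \<forall>z\<in>mspace X. \<forall>z'\<in>mspace X.
        x \<noteq> x' \<longrightarrow> mdist X x x' = mdist X z z' \<longrightarrow> {x, x'} = {z, z'})"

text \<open>The first nonzero digit contributes at least \<open>(1 / 4) ^ m\<close> in absolute
  value, the later ones together at most two thirds of that, so they cannot cancel it. In base 3 the
  tail could reach the full \<open>(1 / 3) ^ m\<close>.\<close>

lemma base_4_digits_unique:
  fixes c :: "nat \<Rightarrow> int"
  assumes c: "\<And>k. \<bar>c k\<bar> \<le> 2" and sum: "(\<Sum>k. of_int (c k) * (1 / 4) ^ k :: real) = 0"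
  shows "c k = 0"
proof (rule ccontr)
  assume "c k \<noteq> 0"
  define m where "m = (LEAST k. c k \<noteq> 0)"
  have m: "c m \<noteq> 0" unfolding m_def using \<open>c k \<noteq> 0\<close> by (rule LeastI)
  have below: "c i = 0" if "i < m" for i using not_less_Least[of i] that unfolding m_def by blast
  define F where "F k = (of_int (c k) * (1 / 4) ^ k :: real)" for k
  have bound: "norm (F k) \<le> 2 * (1 / 4) ^ k" for k
    unfolding F_def using c[of k]
    by (simp add: abs_mult power_abs flip: of_int_abs)
  have geo: "(\<lambda>n. 2 * (1 / 4 :: real) ^ (n + Suc m)) sums (2 / 3 * (1 / 4) ^ m)"
    using sums_mult[OF geometric_sums[of "1 / 4 :: real"], of "2 * (1 / 4) ^ Suc m"]
    by (simp add: power_add mult_ac)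
  have "summable F"
    by (rule summable_comparison_test'[OF _ bound]) (intro summable_mult summable_geometric, simp)
  moreover have "suminf F = 0" using sum by (simp add: F_def[abs_def])
  ultimately have "(\<Sum>n. F (n + Suc m)) + (\<Sum>i<Suc m. F i) = 0"
    using suminf_split_initial_segment[of F "Suc m"] by simp
  moreover have "(\<Sum>i<Suc m. F i) = F m" using below by (simp add: F_def)
  moreover have "norm (\<Sum>n. F (n + Suc m)) \<le> 2 / 3 * (1 / 4) ^ m"
    using norm_suminf_le[OF bound sums_summable[OF geo]] sums_unique[OF geo] by simp
  moreover have "(1 / 4) ^ m \<le> \<bar>F m\<bar>"
  proof -
    have "1 \<le> \<bar>c m\<bar>" using m by linarith
    then have "1 \<le> \<bar>of_int (c m) :: real\<bar>" by linarith
    then show ?thesis by (simp add: F_def abs_mult power_abs)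
  qed
  moreover have "(1 / 4 :: real) ^ m > 0" by simp
  ultimately show False unfolding real_norm_def by linarith
qed

section \<open>Clopen partitions and continuous injections onto Sidon sets\<close>

lemma zero_dim_compact_fine_partition:
  assumes X: "zero_dim_compact X" and e: "e > 0"
  obtains V where "finite V" "\<And>B. B \<in> V \<Longrightarrow> openin (mtopology_of X) B" "\<Union>V = mspace X"
    "disjoint V" "\<And>B x y. B \<in> V \<Longrightarrow> x \<in> B \<Longrightarrow> y \<in> B \<Longrightarrow> mdist X x y < e"
proof -
  interpret Metric_space "mspace X" "mdist X" by (rule Metric_space_mspace_mdist)
  have ref: "covers_refinable (mtopology_of X) 0" and cpt: "compact_space (mtopology_of X)"
    using X by (auto simp: zero_dim_compact_def has_covering_dim_def split: if_splits)
  let ?U = "(\<lambda>x. mball_of X x (e / 2)) ` mspace X"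
  have "\<forall>U\<in>?U. openin (mtopology_of X) U" by (auto simp: mball_of_def mtopology_of_def)
  moreover have "\<Union>?U = topspace (mtopology_of X)" using e by (auto simp: mball_of_def)
  ultimately obtain F where F: "finite F" "F \<subseteq> ?U" "\<Union>F = topspace (mtopology_of X)"
    using cpt unfolding compact_space by meson
  have "finite_open_cover (mtopology_of X) F"
    using F \<open>\<forall>U\<in>?U. openin (mtopology_of X) U\<close> by (auto simp: finite_open_cover_def)
  \<comment> \<open>Order 0 means that no two distinct members meet, so this refinement is a
    partition, up to the empty set.\<close>
  then obtain V where V: "finite_open_cover (mtopology_of X) V" "\<forall>v\<in>V. \<exists>U\<in>F. v \<subseteq> U"
    "cover_has_order V 0"
    using ref unfolding covers_refinable_def by (metis le_zero_eq)
  show ?thesis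
  proof
    show "finite V" "\<And>B. B \<in> V \<Longrightarrow> openin (mtopology_of X) B" "\<Union>V = mspace X"
      using V(1) by (auto simp: finite_open_cover_def)
    show "disjoint V"
    proof (rule disjointI)
      fix A B assume AB: "A \<in> V" "B \<in> V" "A \<noteq> B"
      then have "{A, B} \<subseteq> V" "finite {A, B}" "card {A, B} = 0 + 2" by auto
      then have "\<Inter>{A, B} = {}" using V(3) unfolding cover_has_order_def by blast
      then show "A \<inter> B = {}" by simp
    qed
    show "mdist X x y < e" if B: "B \<in> V" "x \<in> B" "y \<in> B" for B x y
    proof -
      obtain p where p: "x \<in> mball_of X p (e / 2)" "y \<in> mball_of X p (e / 2)"
        using B V(2) F(2) by blast
      then have "mdist X x y \<le> mdist X p x + mdist X p y"
        using triangle'[of x p y] by (simp add: mdist_commute commute)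
      then show ?thesis using p by simp
    qed
  qed
qed

lemma continuous_map_of_bool_clopen:
  assumes "openin T B" "closedin T B"
  shows "continuous_map T euclideanreal (\<lambda>x. of_bool (x \<in> B))"
proof -
  have "openin T {x \<in> topspace T. (of_bool (x \<in> B) :: real) \<in> U}" for U
  proof -
    have "openin T (topspace T - B)" using assms by blast
    moreover have "openin T (topspace T \<inter> B)" using assms by blast
    moreover have "{x \<in> topspace T. (of_bool (x \<in> B) :: real) \<in> U} =
      (if 1 \<in> U then topspace T \<inter> B else {}) \<union> (if 0 \<in> U then topspace T - B else {})"
      by (auto simp: of_bool_def split: if_splits)
    ultimately show ?thesis by (auto intro: openin_Un)
  qed
  then show ?thesis by (simp add: continuous_map_def)
qed

text \<open>Sending a point to the series \<open>\<Sum> [x \<in> B k] / 4^k\<close> turns sums of two values into digit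
  expansions with digits in \<open>{0, 1, 2}\<close>, which determine the digits. Hence the image is a Sidon set.\<close>

lemma zero_dim_compact_Sidon_map:
  assumes X: "zero_dim_compact X"
  obtains f :: "'a \<Rightarrow> real" where "continuous_map (mtopology_of X) euclideanreal f"
    "\<And>x x' z z'. x \<in> mspace X \<Longrightarrow> x' \<in> mspace X \<Longrightarrow> z \<in> mspace X \<Longrightarrow> z' \<in> mspace X \<Longrightarrow>
       f x + f z' = f x' + f z \<Longrightarrow> x = x' \<and> z = z' \<or> x = z \<and> x' = z'"
proof -
  let ?T = "mtopology_of X"
  have "\<exists>V. finite V \<and> (\<forall>B\<in>V. openin ?T B) \<and> \<Union>V = mspace X \<and> disjoint V \<and>
         (\<forall>B\<in>V. \<forall>x\<in>B. \<forall>y\<in>B. mdist X x y < 1 / real (Suc n))" for n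
    by (rule zero_dim_compact_fine_partition[OF X, of "1 / real (Suc n)"]) (simp, metis)
  then obtain V where V: "\<And>n. finite (V n)" "\<And>n B. B \<in> V n \<Longrightarrow> openin ?T B"
    "\<And>n. \<Union>(V n) = mspace X" "\<And>n. disjoint (V n)"
    "\<And>n B x y. B \<in> V n \<Longrightarrow> x \<in> B \<Longrightarrow> y \<in> B \<Longrightarrow> mdist X x y < 1 / real (Suc n)"
    by metis
  have ne: "mspace X \<noteq> {}" using X by (auto simp: zero_dim_compact_def has_covering_dim_def)
  define \<B> where "\<B> = (\<Union>n. V n)"
  have "countable \<B>" unfolding \<B>_def using V(1) by (auto intro: countable_finite)
  have "\<B> \<noteq> {}" using V(3)[of 0] ne by (auto simp: \<B>_def)
  \<comment> \<open>A finite family is enumerated with repetitions, so a set may occupy several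
    digits; only the range matters below.\<close>
  define B where "B = from_nat_into \<B>"
  have range: "range B = \<B>"
    unfolding B_def by (rule range_from_nat_into) fact+
  have clopen: "openin ?T (B k)" "closedin ?T (B k)" for k
  proof -
    have "B k \<in> \<B>" using range by blast
    then obtain n where n: "B k \<in> V n" by (auto simp: \<B>_def)
    then show "openin ?T (B k)" by (rule V(2))
    have "mspace X - B k = \<Union>(V n - {B k})"
      using V(3)[of n] V(4)[of n] n by (auto simp: disjoint_def)
    moreover have "openin ?T (\<Union>(V n - {B k}))" using V(2) by blast
    moreover have "B k \<subseteq> mspace X" using V(3) n by blast
    ultimately show "closedin ?T (B k)" by (simp add: closedin_def)
  qed
  \<comment> \<open>Two points are avoided at once: a digit that is present for \<open>x\<close> and
    absent for both \<open>x'\<close> and \<open>z\<close> is what will contradict equality of the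
    two sums.\<close>
  have sep: "\<exists>k. x \<in> B k \<and> y \<notin> B k \<and> z \<notin> B k"
    if "x \<in> mspace X" "y \<in> mspace X" "z \<in> mspace X" "x \<noteq> y" "x \<noteq> z" for x y z
  proof -
    have "min (mdist X x y) (mdist X x z) > 0"
      using that by (metis mdist_nonneg mdist_zero min_less_iff_conj less_eq_real_def)
    then obtain n where n: "1 / real (Suc n) < min (mdist X x y) (mdist X x z)"
      using nat_approx_posE by blast
    have "x \<in> \<Union>(V n)" using V(3)[of n] that(1) by simp
    then obtain A where A: "A \<in> V n" "x \<in> A" by (elim UnionE)
    have "y \<notin> A" "z \<notin> A" using V(5)[OF A, of y] V(5)[OF A, of z] n by auto
    moreover have "A \<in> range B" unfolding range \<B>_def using A by blast
    ultimately show ?thesis using A by blast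
  qed
  define g where "g k x = (of_bool (x \<in> B k) * (1 / 4) ^ k :: real)" for k x
  define f where "f x = (\<Sum>k. g k x)" for x
  have bound: "norm (g k x) \<le> (1 / 4) ^ k" for k x by (simp add: g_def)
  have summ: "summable (\<lambda>k. g k x)" for x
    by (rule summable_comparison_test'[OF _ bound]) (rule summable_geometric, simp)
  show ?thesis
  proof
    have "continuous_map ?T Met_TC.mtopology f"
    proof (rule Met_TC.continuous_map_uniform_limit[where F = sequentially and f = "\<lambda>n x. \<Sum>k<n. g k x"])
      show "\<forall>\<^sub>F n in sequentially. continuous_map ?T Met_TC.mtopology (\<lambda>x. \<Sum>k<n. g k x)"
      proof (intro always_eventually allI)
        have "continuous_map ?T euclideanreal (g k)" for k
          unfolding g_def
          by (intro continuous_map_real_mult continuous_map_of_bool_clopen clopen) simp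
        then show "continuous_map ?T Met_TC.mtopology (\<lambda>x. \<Sum>k<n. g k x)" for n
          by (auto intro: continuous_map_sum)
      qed
      fix e :: real assume "e > 0"
      have "(\<lambda>n. 4 / 3 * (1 / 4 :: real) ^ n) \<longlonglongrightarrow> 4 / 3 * 0"
        by (intro tendsto_mult tendsto_const LIMSEQ_power_zero) simp
      then have "\<forall>\<^sub>F n in sequentially. 4 / 3 * (1 / 4 :: real) ^ n < e"
        by (rule order_tendstoD(2)) (simp add: \<open>e > 0\<close>)
      then show "\<forall>\<^sub>F n in sequentially. \<forall>x\<in>topspace ?T. f x \<in> UNIV \<and> dist (\<Sum>k<n. g k x) (f x) < e"
      proof (eventually_elim, intro ballI conjI UNIV_I)
        fix n x assume n: "4 / 3 * (1 / 4 :: real) ^ n < e"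
        \<comment> \<open>A bound on the tail that does not depend on \<open>x\<close>, hence
          uniform convergence of the continuous partial sums.\<close>
        have geo: "(\<lambda>k. (1 / 4 :: real) ^ (k + n)) sums (4 / 3 * (1 / 4) ^ n)"
          using sums_mult[OF geometric_sums[of "1 / 4 :: real"], of "(1 / 4) ^ n"]
          by (simp add: power_add mult_ac)
        have "norm (\<Sum>k. g (k + n) x) \<le> 4 / 3 * (1 / 4) ^ n"
          using norm_suminf_le[OF bound sums_summable[OF geo]] sums_unique[OF geo] by simp
        then show "dist (\<Sum>k<n. g k x) (f x) < e"
          using suminf_split_initial_segment[OF summ, of x n] n
          by (simp add: f_def dist_norm)
      qed
    qed auto
    then show "continuous_map ?T euclideanreal f" by simp
  next
    fix x x' z z'
    assume mem: "x \<in> mspace X" "x' \<in> mspace X" "z \<in> mspace X" "z' \<in> mspace X"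
      and eq: "f x + f z' = f x' + f z"
    \<comment> \<open>Each entry is a difference of two digits from \<open>{0, 1, 2}\<close>, so it
      lies between -2 and 2 as \<open>base_4_digits_unique\<close> demands.\<close>
    define c :: "nat \<Rightarrow> int" where
      "c k = of_bool (x \<in> B k) + of_bool (z' \<in> B k) - of_bool (x' \<in> B k) - of_bool (z \<in> B k)" for k
    have "(\<Sum>k. of_int (c k) * (1 / 4) ^ k :: real) = (\<Sum>k. g k x + g k z' - g k x' - g k z)"
      by (simp add: c_def g_def algebra_simps)
    also have "\<dots> = f x + f z' - f x' - f z"
      unfolding f_def using summ
      by (simp add: suminf_add suminf_diff summable_add summable_diff)
    finally have c0: "c k = 0" for k
      using eq by (intro base_4_digits_unique) (auto simp: c_def)
    have digits: "of_bool (x \<in> B k) + of_bool (z' \<in> B k) = (of_bool (x' \<in> B k) + of_bool (z \<in> B k) :: int)" for k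
      using c0[of k] unfolding c_def by linarith
    have "x = x' \<or> x = z"
    proof (rule ccontr)
      assume "\<not> ?thesis"
      then obtain k where "x \<in> B k" "x' \<notin> B k" "z \<notin> B k" using sep mem by blast
      then show False using digits[of k] by (auto split: if_splits simp: of_bool_def)
    qed
    \<comment> \<open>The digits of \<open>x = x'\<close> cancel, leaving two points to separate;
      \<open>sep\<close> is applied with its last two arguments equal.\<close>
    moreover have "z = z'" if "x = x'"
    proof (rule ccontr)
      assume "z \<noteq> z'"
      then obtain k where "z \<in> B k" "z' \<notin> B k" using sep[of z z' z'] mem by blast
      then show False using digits[of k] that by simp
    qed
    moreover have "x' = z'" if "x = z"
    proof (rule ccontr)
      assume "x' \<noteq> z'"
      then obtain k where "x' \<in> B k" "z' \<notin> B k" using sep[of x' z' z'] mem by blast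
      then show False using digits[of k] that by simp
    qed
    ultimately show "x = x' \<and> z = z' \<or> x = z \<and> x' = z'" by blast
  qed
qed

lemma loosely_embeddable_if_distinct_distances:
  assumes X: "zero_dim_compact X" and dd: "distinct_distances X"
  shows "loosely_embeddable X (euclidean_metric :: real metric)"
proof -
  obtain f :: "'a \<Rightarrow> real" where cont: "continuous_map (mtopology_of X) euclideanreal f"
    and Sidon: "\<And>x x' z z'. x \<in> mspace X \<Longrightarrow> x' \<in> mspace X \<Longrightarrow> z \<in> mspace X \<Longrightarrow> z' \<in> mspace X \<Longrightarrow>
       f x + f z' = f x' + f z \<Longrightarrow> x = x' \<and> z = z' \<or> x = z \<and> x' = z'"
    using zero_dim_compact_Sidon_map[OF X] by metis
  \<comment> \<open>The case \<open>z = z' = x'\<close> of the Sidon property: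
    \<open>f x + f x' = f x' + f x'\<close>.\<close>
  have inj: "x = x'" if "x \<in> mspace X" "x' \<in> mspace X" "f x = f x'" for x x'
    using Sidon[of x x' x' x'] that by auto
  have "dist (f x) (f x') = dist (f z) (f z') \<longleftrightarrow> mdist X x x' = mdist X z z'"
    if m: "x \<in> mspace X" "x' \<in> mspace X" "z \<in> mspace X" "z' \<in> mspace X" for x x' z z'
  proof
    assume "dist (f x) (f x') = dist (f z) (f z')"
    \<comment> \<open>Removing the absolute values leaves two cases, one for each relative
      orientation of the pairs; exchanging \<open>z\<close> and \<open>z'\<close> turns one into the
      other.\<close>
    then have "f x + f z' = f x' + f z \<or> f x + f z = f x' + f z'"
      by (auto simp: dist_real_def abs_if split: if_splits)
    then have "x = x' \<and> z = z' \<or> {x, x'} = {z, z'}"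
      using Sidon[OF m(1,2,3,4)] Sidon[OF m(1,2,4,3)] by blast
    then show "mdist X x x' = mdist X z z'"
    proof
      assume "x = x' \<and> z = z'"
      then have "mdist X x x' = 0" "mdist X z z' = 0" using m by auto
      then show ?thesis by simp
    qed (auto simp: doubleton_eq_iff mdist_commute)
  next
    assume eq: "mdist X x x' = mdist X z z'"
    show "dist (f x) (f x') = dist (f z) (f z')"
    proof (cases "x = x'")
      case True
      then have "z = z'" using eq m by (metis mdist_zero)
      then show ?thesis using True by simp
    next
      case False
      then have "{x, x'} = {z, z'}" using dd eq m unfolding distinct_distances_def by blast
      then show ?thesis by (auto simp: doubleton_eq_iff dist_commute)
    qed
  qed
  then have "loose_embedding X (euclidean_metric :: real metric) f"
    unfolding loose_embedding_def using cont inj by (auto intro!: inj_onI)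
  then show ?thesis unfolding loosely_embeddable_def by blast
qed


section \<open>Density and stability of distinct distances\<close>

lemma has_covering_dim_0_discrete_topology:
  assumes "finite S" "S \<noteq> {}"
  shows "has_covering_dim (discrete_topology S) 0"
proof -
  have "covers_refinable (discrete_topology S) 0"
    unfolding covers_refinable_def
  proof (intro allI impI)
    fix \<U> assume U: "finite_open_cover (discrete_topology S) \<U>"
    let ?V = "(\<lambda>x. {x}) ` S"
    have "cover_has_order ?V 0"
      unfolding cover_has_order_def
    proof
      obtain x where "x \<in> S" using assms by blast
      then show "\<exists>\<F>\<subseteq>?V. finite \<F> \<and> card \<F> = 0 + 1 \<and> \<Inter>\<F> \<noteq> {}"
        by (intro exI[of _ "{{x}}"]) auto
      show "\<not> (\<exists>\<F>\<subseteq>?V. finite \<F> \<and> card \<F> = 0 + 2 \<and> \<Inter>\<F> \<noteq> {})"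
      proof clarify
        fix \<F> assume F: "\<F> \<subseteq> ?V" "card \<F> = 0 + 2" and "\<Inter>\<F> \<noteq> {}"
        then obtain p where p: "p \<in> \<Inter>\<F>" by blast
        have "\<F> \<subseteq> {{p}}" using F(1) p by blast
        then have "card \<F> \<le> card {{p}}" by (intro card_mono) auto
        then show False using F(2) by simp
      qed
    qed
    moreover have "finite_open_cover (discrete_topology S) ?V"
      using assms by (auto simp: finite_open_cover_def)
    moreover have "\<forall>V\<in>?V. \<exists>U\<in>\<U>. V \<subseteq> U"
      using U by (auto simp: finite_open_cover_def)
    ultimately show "\<exists>\<V>. finite_open_cover (discrete_topology S) \<V> \<and> (\<forall>V\<in>\<V>. \<exists>U\<in>\<U>. V \<subseteq> U) \<and>
             (\<exists>k\<le>0. cover_has_order \<V> k)"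
      by (intro exI[of _ ?V]) simp
  qed
  then show ?thesis using assms by (auto simp: has_covering_dim_def)
qed

lemma finite_imp_zero_dim_compact:
  assumes "finite (mspace X)" "mspace X \<noteq> {}"
  shows "zero_dim_compact X"
proof -
  interpret Metric_space "mspace X" "mdist X" by (rule Metric_space_mspace_mdist)
  have "mtopology_of X = discrete_topology (mspace X)"
    using assms by (intro finite_t1_space_imp_discrete_topology)
      (simp_all add: mtopology_of_def t1_space_mtopology)
  then show ?thesis
    using assms has_covering_dim_0_discrete_topology
    by (simp add: zero_dim_compact_def compact_space_discrete_topology)
qed

text \<open>Greedy choice: the finitely many values already taken leave infinitely many. It will
  assign distances to the pairs of points of a finite net.\<close>

lemma inj_choice_infinite:
  assumes "finite P" "\<And>p. p \<in> P \<Longrightarrow> infinite (I p)"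
  obtains w where "inj_on w P" "\<And>p. p \<in> P \<Longrightarrow> w p \<in> I p"
proof -
  have "\<exists>w. inj_on w P \<and> (\<forall>p\<in>P. w p \<in> I p)"
    using assms
  proof (induction P rule: finite_induct)
    case empty
    then show ?case by simp
  next
    case (insert q P)
    then obtain w where w: "inj_on w P" "\<forall>p\<in>P. w p \<in> I p" by auto
    have "infinite (I q - w ` P)" using insert by (simp add: Diff_infinite_finite)
    then obtain t where t: "t \<in> I q" "t \<notin> w ` P" using infinite_imp_nonempty by blast
    have "inj_on (w(q := t)) (insert q P)"
      using w(1) t(2) insert(2) by (auto simp: inj_on_def)
    moreover have "\<forall>p\<in>insert q P. (w(q := t)) p \<in> I p" using w(2) t(1) by auto
    ultimately show ?case by blast
  qed
  then show ?thesis using that by blast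
qed

text \<open>Adding to each distance of an \<open>r\<close>-net any number between \<open>r\<close> and \<open>2 * r\<close> preserves the triangle
  inequality, which leaves room to make the distances pairwise different.\<close>

lemma distinct_distances_dense:
  fixes X :: "'a metric"
  assumes cpt: "compact_space (mtopology_of X)" and ne: "mspace X \<noteq> {}" and e: "e > 0"
  obtains Y :: "'a metric" where "finite (mspace Y)" "mspace Y \<noteq> {}" "distinct_distances Y"
    "gh_dist X Y \<le> e"
proof -
  interpret X: Metric_space "mspace X" "mdist X" by (rule Metric_space_mspace_mdist)
  \<comment> \<open>Moving both endpoints into the net costs \<open>2 * r\<close>, changing the
    distances of the net another \<open>2 * r\<close>. The distortion \<open>4 * r = 2 * e\<close>
    gives distance at most \<open>e\<close>.\<close>
  define r where "r = e / 2"
  have r: "r > 0" using e by (simp add: r_def)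
  have "\<exists>S\<subseteq>mspace X. finite S \<and> mspace X = (\<Union>s\<in>S. mball_of X s r)"
  proof -
    let ?U = "(\<lambda>x. mball_of X x r) ` mspace X"
    have "\<forall>U\<in>?U. openin (mtopology_of X) U" by (auto simp: mball_of_def mtopology_of_def)
    moreover have "\<Union>?U = topspace (mtopology_of X)" using r by (auto simp: mball_of_def)
    ultimately obtain F where F: "finite F" "F \<subseteq> ?U" "\<Union>F = topspace (mtopology_of X)"
      using cpt unfolding compact_space by meson
    then obtain S where "S \<subseteq> mspace X" "finite S" "F = (\<lambda>x. mball_of X x r) ` S"
      by (meson finite_subset_image)
    then show ?thesis using F(3) by (intro exI[of _ S]) auto
  qed
  then obtain S where S: "S \<subseteq> mspace X" "finite S" "mspace X = (\<Union>s\<in>S. mball_of X s r)"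
    by blast
  have Sne: "S \<noteq> {}" using S(3) ne by blast
  define P where "P = {A. A \<subseteq> S \<and> card A = 2}"
  have "finite P" unfolding P_def using S(2) by simp
  \<comment> \<open>Indexing by two-element sets builds in symmetry, and injectivity of
    \<open>w\<close> says that different pairs get different distances. Both orders of
    \<open>a\<close> and \<open>b\<close> give the same interval.\<close>
  define I where "I A = {t. \<forall>a b. A = {a, b} \<longrightarrow> mdist X a b + r \<le> t \<and> t \<le> mdist X a b + 2 * r}" for A
  have Iab: "I {a, b} = {mdist X a b + r .. mdist X a b + 2 * r}" for a b
    unfolding I_def by (auto simp: doubleton_eq_iff mdist_commute)
  have "infinite (I A)" if "A \<in> P" for A
  proof -
    have "card A = 2" using that by (simp add: P_def)
    then obtain a b where "A = {a, b}" unfolding card_2_iff by blast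
    then show ?thesis using r by (simp add: Iab)
  qed
  then obtain w where w: "inj_on w P" "\<And>A. A \<in> P \<Longrightarrow> w A \<in> I A"
    using inj_choice_infinite[OF \<open>finite P\<close>] by metis
  define d where "d a b = (if a \<in> S \<and> b \<in> S \<and> a \<noteq> b then w {a, b} else 0)" for a b
  have inP: "{a, b} \<in> P" if "a \<in> S" "b \<in> S" "a \<noteq> b" for a b
    using that by (simp add: P_def)
  have d: "mdist X a b + r \<le> d a b" "d a b \<le> mdist X a b + 2 * r"
    if "a \<in> S" "b \<in> S" "a \<noteq> b" for a b
    using w(2)[OF inP[OF that]] that by (auto simp: Iab d_def)
  have d_pos: "d a b > 0" if "a \<in> S" "b \<in> S" "a \<noteq> b" for a b
    using d(1)[OF that] r mdist_nonneg[of X a b] by linarith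
  have d_ge0: "0 \<le> d a b" for a b
    using d_pos[of a b] by (cases "a \<in> S \<and> b \<in> S \<and> a \<noteq> b") (auto simp: d_def)
  have d_comm: "d a b = d b a" for a b by (auto simp: d_def insert_commute)
  have d_self: "d a a = 0" for a by (simp add: d_def)
  interpret Y: Metric_space S d
  proof
    show "0 \<le> d a b" "d a b = d b a" for a b by (rule d_ge0, rule d_comm)
    show "d a b = 0 \<longleftrightarrow> a = b" if "a \<in> S" "b \<in> S" for a b
      using d_pos[OF that] d_self by fastforce
    show "d a c \<le> d a b + d b c" if m: "a \<in> S" "b \<in> S" "c \<in> S" for a b c
    proof (cases "a = b \<or> b = c \<or> a = c")
      case True
      then show ?thesis using d_self d_ge0 by auto
    next
      case False
      \<comment> \<open>The excess of at most \<open>2 * r\<close> on the left is paid by the two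
        excesses of at least \<open>r\<close> on the right.\<close>
      have "mdist X a c \<le> mdist X a b + mdist X b c" using m S(1) by (intro mdist_triangle) auto
      then show ?thesis
        using False d(2)[of a c] d(1)[of a b] d(1)[of b c] m by auto
    qed
  qed
  define Y where "Y = metric (S, d)"
  have Y[simp]: "mspace Y = S" "mdist Y = d"
    by (simp_all add: Y_def)
  show ?thesis
  proof
    show "finite (mspace Y)" "mspace Y \<noteq> {}" using S Sne by auto
    show "distinct_distances Y"
      unfolding distinct_distances_def Y
    proof (intro ballI impI)
      fix a a' b b' assume m: "a \<in> S" "a' \<in> S" "b \<in> S" "b' \<in> S" "a \<noteq> a'" "d a a' = d b b'"
      then have "b \<noteq> b'" using d_pos[of a a'] d_self[of b] by auto
      then have "w {a, a'} = w {b, b'}" using m by (simp add: d_def)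
      then show "{a, a'} = {b, b'}"
        using w(1) inP[of a a'] inP[of b b'] m \<open>b \<noteq> b'\<close> by (auto dest: inj_onD)
    qed
    have near: "\<bar>mdist X a b - d a b\<bar> \<le> 2 * r" if "a \<in> S" "b \<in> S" for a b
    proof (cases "a = b")
      case True
      then have "mdist X a b = 0" using that S(1) by auto
      then show ?thesis using True r d_self by simp
    next
      case False
      then show ?thesis using d[OF that False] r by (simp add: abs_le_iff)
    qed
    define R where "R = {(x, s). x \<in> mspace X \<and> s \<in> S \<and> mdist X s x < r}"
    have "\<bar>mdist X x x' - d s s'\<bar> \<le> 2 * e" if "(x, s) \<in> R" "(x', s') \<in> R" for x s x' s'
    proof -
      have m: "x \<in> mspace X" "x' \<in> mspace X" "s \<in> S" "s' \<in> S" "mdist X s x < r" "mdist X s' x' < r"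
        using that by (auto simp: R_def)
      then have s: "s \<in> mspace X" "s' \<in> mspace X" using S(1) by auto
      show ?thesis
        using X.triangle[OF m(1) s(1) m(2)] X.triangle[OF s(1) s(2) m(2)]
          X.triangle[OF s(1) m(1) s(2)] X.triangle[OF m(1) m(2) s(2)]
          mdist_commute[of X x s] mdist_commute[of X x' s'] near[OF m(3,4)] m(5,6)
        unfolding r_def by linarith
    qed
    moreover have "\<exists>s. (x, s) \<in> R" if x: "x \<in> mspace X" for x
    proof -
      have "x \<in> (\<Union>s\<in>S. mball_of X s r)" using x S(3) by blast
      then show ?thesis by (auto simp: R_def)
    qed
    moreover have "\<exists>x. (x, s) \<in> R" if "s \<in> S" for s
    proof -
      have "s \<in> mspace X" using that S(1) by blast
      then have "(s, s) \<in> R" using that r by (simp add: R_def)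
      then show ?thesis by blast
    qed
    ultimately have "correspondence X Y (2 * e) R"
      unfolding correspondence_def Y by (intro conjI) (auto simp: R_def)
    moreover have "bounded_space X" by (rule compact_imp_bounded_space[OF cpt ne])
    moreover have "bounded_space Y"
      using finite_imp_zero_dim_compact zero_dim_compactD(3) \<open>finite (mspace Y)\<close> \<open>mspace Y \<noteq> {}\<close>
      by blast
    ultimately show "gh_dist X Y \<le> e" using e by (intro gh_dist_le)
  qed
qed

text \<open>The endpoints of the two pairs can be matched in two ways; under each, at least one
  endpoint must move by the margin. This keeps the coincidence away from a pair compared with
  itself.\<close>

definition near_coincidence :: "nat \<Rightarrow> 'a metric \<Rightarrow> bool" where
  "near_coincidence n X \<longleftrightarrow>
     (\<exists>x\<in>mspace X. \<exists>x'\<in>mspace X. \<exists>z\<in>mspace X. \<exists>z'\<in>mspace X.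
        mdist X x x' = mdist X z z' \<and> 1 / Suc n \<le> mdist X x x' \<and>
        1 / Suc n \<le> max (mdist X x z) (mdist X x' z') \<and>
        1 / Suc n \<le> max (mdist X x z') (mdist X x' z))"

lemma not_distinct_distances_imp_coincidence:
  assumes "\<not> distinct_distances X"
  obtains n where "near_coincidence n X"
proof -
  obtain x x' z z' where m: "x \<in> mspace X" "x' \<in> mspace X" "z \<in> mspace X" "z' \<in> mspace X"
    and eq: "mdist X x x' = mdist X z z'" and ne: "x \<noteq> x'" "{x, x'} \<noteq> {z, z'}"
    using assms unfolding distinct_distances_def by blast
  let ?a = "mdist X x x'" and ?b = "max (mdist X x z) (mdist X x' z')"
    and ?c = "max (mdist X x z') (mdist X x' z)"
  have pos: "mdist X u v > 0" if "u \<in> mspace X" "v \<in> mspace X" "u \<noteq> v" for u v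
    using that mdist_zero[of u X v] mdist_nonneg[of X u v] by linarith
  have "?a > 0" using pos m ne by blast
  moreover have "?b > 0" using pos[OF m(1,3)] pos[OF m(2,4)] ne(2) by (auto simp: less_max_iff_disj)
  moreover have "?c > 0" using pos[OF m(1,4)] pos[OF m(2,3)] ne(2) by (auto simp: less_max_iff_disj)
  ultimately have "min ?a (min ?b ?c) > 0" by simp
  then obtain n where n: "1 / Suc n < min ?a (min ?b ?c)" by (rule nat_approx_posE)
  show ?thesis
  proof
    show "near_coincidence n X"
      unfolding near_coincidence_def
      by (rule bexI[OF _ m(1)], rule bexI[OF _ m(2)], rule bexI[OF _ m(3)], rule bexI[OF _ m(4)])
        (use eq n in linarith)
  qed
qed

text \<open>Equal distances in \<open>W\<close> correspond to distances in \<open>Y\<close> that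
  differ by at most \<open>2 * r\<close>. This is below the gap \<open>\<mu>\<close> between
  different distances of \<open>Y\<close>, so they are equal and come from one pair. But points of
  \<open>W\<close> related to the same point of \<open>Y\<close> are within
  \<open>r < 1 / Suc n\<close>, against the margin.\<close>

lemma distinct_distances_stable:
  fixes Y :: "'b metric"
  assumes fin: "finite (mspace Y)" and dd: "distinct_distances Y"
  obtains r where "r > 0"
    "\<And>(W :: 'a metric) R. correspondence W Y r R \<Longrightarrow> \<not> near_coincidence n W"
proof -
  define D where "D = (\<lambda>(y, y', z, z'). \<bar>mdist Y y y' - mdist Y z z'\<bar>) `
    (mspace Y \<times> mspace Y \<times> mspace Y \<times> mspace Y)"
  have "finite (insert 1 (D \<inter> {0<..}))" unfolding D_def using fin by blast
  \<comment> \<open>The element 1 keeps the minimum meaningful when no two distances of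
    \<open>Y\<close> differ, as in a one-point space.\<close>
  define \<mu> where "\<mu> = Min (insert 1 (D \<inter> {0<..}))"
  have mu: "\<mu> > 0" "\<And>t. t \<in> D \<Longrightarrow> t > 0 \<Longrightarrow> \<mu> \<le> t"
    unfolding \<mu>_def using \<open>finite (insert 1 (D \<inter> {0<..}))\<close> by (auto simp: Min_gr_iff)
  define r where "r = min (\<mu> / 3) (1 / (2 * Suc n))"
  have r: "r > 0" "2 * r < \<mu>" "r < 1 / Suc n"
  proof -
    have "(1 / (2 * Suc n) :: real) < 1 / Suc n" by (simp add: field_simps)
    then show "r > 0" "2 * r < \<mu>" "r < 1 / Suc n" using mu(1) unfolding r_def by auto
  qed
  show ?thesis
  proof
    show "r > 0" by fact
    fix W :: "'a metric" and R assume R: "correspondence W Y r R"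
    show "\<not> near_coincidence n W"
    proof
      assume "near_coincidence n W"
      then obtain x x' z z' where m: "x \<in> mspace W" "x' \<in> mspace W" "z \<in> mspace W" "z' \<in> mspace W"
        and eq: "mdist W x x' = mdist W z z'" and far: "1 / Suc n \<le> mdist W x x'"
          "1 / Suc n \<le> max (mdist W x z) (mdist W x' z')"
          "1 / Suc n \<le> max (mdist W x z') (mdist W x' z)"
        unfolding near_coincidence_def by blast
      obtain y y' v v' where yR: "(x, y) \<in> R" "(x', y') \<in> R" "(z, v) \<in> R" "(z', v') \<in> R"
        using correspondenceD(3)[OF R] m by meson
      note dis = correspondenceD(5)[OF R]
      have mY: "y \<in> mspace Y" "y' \<in> mspace Y" "v \<in> mspace Y" "v' \<in> mspace Y"
        using correspondenceD(2)[OF R] yR by blast+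
      have self: "mdist Y u u = 0" if "u \<in> mspace Y" for u using that by simp
      have "\<bar>mdist Y y y' - mdist Y v v'\<bar> \<in> D"
        unfolding D_def using mY by (intro image_eqI[of _ _ "(y, y', v, v')"]) auto
      moreover have "\<bar>mdist Y y y' - mdist Y v v'\<bar> < \<mu>"
        using dis[OF yR(1,2)] dis[OF yR(3,4)] eq r(2) by linarith
      ultimately have "mdist Y y y' = mdist Y v v'" using mu(2) by fastforce
      moreover have "y \<noteq> y'" using dis[OF yR(1,2)] far(1) r(3) self[OF mY(1)] by auto
      ultimately have "{y, y'} = {v, v'}" using dd mY unfolding distinct_distances_def by blast
      then consider "y = v" "y' = v'" | "y = v'" "y' = v" by (auto simp: doubleton_eq_iff)
      then show False
      proof cases
        case 1
        then show False
          using dis[OF yR(1,3)] dis[OF yR(2,4)] far(2) r(3) self[OF mY(1)] self[OF mY(2)] by auto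
      next
        case 2
        then show False
          using dis[OF yR(1,4)] dis[OF yR(2,3)] far(3) r(3) self[OF mY(1)] self[OF mY(2)] by auto
      qed
    qed
  qed
qed


section \<open>Residuality\<close>

theorem theorem3p1:
  shows "residual_in gh_topology
           (isometry_class `
              {X. zero_dim_compact X \<and> loosely_embeddable X (euclidean_metric :: real metric)})"
proof -
  define \<delta> where "\<delta> P Q = (if P \<in> M0 \<and> Q \<in> M0 then gh_class_dist P Q else 0)" for P Q
  interpret M: Metric_space M0 \<delta>
    unfolding \<delta>_def[abs_def] by (rule Metric_space_M0)
  have top: "gh_topology = M.mtopology" by (simp add: gh_topology_def \<delta>_def[abs_def])
  have in_M0: "isometry_class X \<in> M0" if "zero_dim_compact X" for X
    using that by (simp add: M0_def)
  have dist: "\<delta> (isometry_class X) (isometry_class Y) = gh_dist X Y"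
    if "zero_dim_compact X" "zero_dim_compact Y" for X Y
    using that by (simp add: \<delta>_def in_M0 gh_class_dist_isometry_class)
  let ?G = "isometry_class ` {X. zero_dim_compact X \<and> loosely_embeddable X (euclidean_metric :: real metric)}"
  define F where "F n = isometry_class ` {X. zero_dim_compact X \<and> near_coincidence n X}" for n
  \<comment> \<open>\<open>meager_in\<close> asks for closed sets with empty interior, hence the
    closures of the \<open>F n\<close>.\<close>
  have "M.mtopology interior_of (M.mtopology closure_of (F n)) = {}" for n
  proof (rule ccontr)
    assume "\<not> ?thesis"
    then obtain P \<epsilon> where P: "P \<in> M0" "\<epsilon> > 0" "M.mball P \<epsilon> \<subseteq> M.mtopology closure_of (F n)"
      unfolding M.metric_interior_of by blast
    obtain X where X: "P = isometry_class X" "zero_dim_compact X"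
      using P(1) by (auto simp: M0_def)
    obtain Y :: "real metric" where Y: "finite (mspace Y)" "mspace Y \<noteq> {}" "distinct_distances Y"
      "gh_dist X Y \<le> \<epsilon> / 2"
      using distinct_distances_dense[OF zero_dim_compactD(1,2)[OF X(2)], of "\<epsilon> / 2"] P(2) by auto
    have Y0: "zero_dim_compact Y" using Y(1,2) by (rule finite_imp_zero_dim_compact)
    have "isometry_class Y \<in> M.mball P \<epsilon>"
      using X Y(4) Y0 P(2) by (simp add: in_M0 dist)
    then have cl: "isometry_class Y \<in> M.mtopology closure_of (F n)" using P(3) by blast
    obtain r where r: "r > 0" "\<And>(W :: real metric) R. correspondence W Y r R \<Longrightarrow> \<not> near_coincidence n W"
      using distinct_distances_stable[OF Y(1,3)] by metis
    \<comment> \<open>A distance below \<open>r / 2\<close> yields a correspondence of distortion at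
      most \<open>r\<close>, the tolerance of \<open>Y\<close>.\<close>
    have "r / 2 > 0" using r(1) by simp
    with cl obtain Q where Q: "Q \<in> F n" "Q \<in> M.mball (isometry_class Y) (r / 2)"
      unfolding M.metric_closure_of by blast
    then obtain W where W: "Q = isometry_class W" "zero_dim_compact W" "near_coincidence n W"
      by (auto simp: F_def)
    have bW: "bounded_space W" and bY: "bounded_space Y" using W(2) Y0 zero_dim_compactD(3) by auto
    have "gh_dist Y W < r / 2" using Q(2) W Y0 by (simp add: dist)
    then have lt: "gh_dist W Y < r / 2" by (simp add: gh_dist_commute[OF bW bY])
    obtain R where "correspondence W Y (2 * (r / 2)) R" by (rule gh_dist_lessE[OF bW bY lt])
    then show False using r(2) W(3) by auto
  qed
  moreover have "closedin M.mtopology (M.mtopology closure_of (F n))" for n by simp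
  moreover have "M0 - ?G \<subseteq> (\<Union>n. M.mtopology closure_of (F n))"
  proof
    fix P assume P: "P \<in> M0 - ?G"
    then obtain X where X: "P = isometry_class X" "zero_dim_compact X" by (auto simp: M0_def)
    have "\<not> loosely_embeddable X (euclidean_metric :: real metric)" using P X by blast
    then have "\<not> distinct_distances X"
      using loosely_embeddable_if_distinct_distances[OF X(2)] by blast
    then obtain n where "near_coincidence n X" by (rule not_distinct_distances_imp_coincidence)
    then have "P \<in> F n" using X by (auto simp: F_def)
    moreover have "F n \<subseteq> M.mtopology closure_of (F n)"
      by (rule closure_of_subset) (auto simp: F_def in_M0)
    ultimately show "P \<in> (\<Union>n. M.mtopology closure_of (F n))" by blast
  qed
  ultimately have "meager_in M.mtopology (M0 - ?G)"
    unfolding meager_in_def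
    by (intro conjI exI[of _ "range (\<lambda>n. M.mtopology closure_of (F n))"]) auto
  moreover have "?G \<subseteq> M0" using in_M0 by blast
  ultimately show ?thesis unfolding residual_in_def top by simp
qed

end
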